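(* Let $G=I_{2}(m)$ with Coxeter generators $s_1, s_2$, where $m\ge2$ is an integer or $m=\infty$, and let $b=s_1$, $a=s_1\cdot s_2$. Then: (1) $b=s_1$; (2) $b\cdot a=s_2$; (3) $b\cdot a^{i}=(s_2\cdot s_1)^{i-1}\cdot s_2$ for every $1<i\leq\frac{m+1}{2}$ in case of finite $m$, and for every $i>1$ in case of infinite $m$; (4) $b\cdot a^{i}=(s_1\cdot s_2)^{m-i}\cdot s_1$ for every $\frac{m+1}{2}\leq i<m$ in case of finite $m$, and $b\cdot a^{i}=(s_1\cdot s_2)^{-i}\cdot s_1$ for every $i<0$ in case of infinite $m$; (5) $a^{i}=(s_1\cdot s_2)^{i}$ for every $0<i\leq \frac{m}{2}$ in case of finite $m$, and for every $i>0$ in case of infinite $m$; (6) $a^{i}=(s_2\cdot s_1)^{m-i}$ for every $\frac{m}{2}\leq i<m$ in case of finite $m$, and $a^{i}=(s_2\cdot s_1)^{-i}$ for every $i<0$ in case of infinite $m$.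
   Context: $I_2(m)=\langle s_1,s_2\mid s_1^2=s_2^2=1,(s_1s_2)^m=1\rangle$ for finite $m$, and $I_2(\infty)=\langle s_1,s_2\mid s_1^2=s_2^2=1\rangle$. *)

theory Defs
  imports "HOL-Algebra.Group" "HOL-Library.Extended_Nat"
begin

text \<open>
  Group presentations.  A word over the generators \<open>'g\<close> is a list of letters; the letter
  \<open>(x, True)\<close> stands for the generator \<open>x\<close> and \<open>(x, False)\<close> for its formal inverse.
\<close>

type_synonym 'g word = "('g \<times> bool) list"

text \<open>
  The congruence on words generated by free cancellation and by deleting relators;
  two words are related iff they represent the same element of the group presented by \<open>R\<close>.
\<close>

inductive pres_cong :: "'g word set \<Rightarrow> 'g word \<Rightarrow> 'g word \<Rightarrow> bool" for R where
  pc_refl: "pres_cong R u u"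
| pc_sym: "pres_cong R u v \<Longrightarrow> pres_cong R v u"
| pc_trans: "pres_cong R u v \<Longrightarrow> pres_cong R v w \<Longrightarrow> pres_cong R u w"
| pc_cancel: "pres_cong R (u @ [(x, e), (x, \<not> e)] @ v) (u @ v)"
| pc_relator: "r \<in> R \<Longrightarrow> pres_cong R (u @ r @ v) (u @ v)"

definition word_class :: "'g word set \<Rightarrow> 'g word \<Rightarrow> 'g word set" where
  "word_class R u = {v. pres_cong R u v}"

definition presented_group :: "'g word set \<Rightarrow> 'g word set monoid" where
  "presented_group R =
     \<lparr>carrier = range (word_class R),
      mult = (\<lambda>X Y. {w. \<exists>u\<in>X. \<exists>v\<in>Y. pres_cong R (u @ v) w}),
      one = word_class R []\<rparr>"

definition pres_gen :: "'g word set \<Rightarrow> 'g \<Rightarrow> 'g word set" where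
  "pres_gen R x = word_class R [(x, True)]"


text \<open>The dihedral groups \<open>I\<^sub>2(m)\<close>; for \<open>m = \<infinity>\<close> the third relator is absent.\<close>

datatype coxeter_gen = S1 | S2

definition I2_relators :: "enat \<Rightarrow> coxeter_gen word set" where
  "I2_relators m =
     {[(S1, True), (S1, True)], [(S2, True), (S2, True)]}
     \<union> {concat (replicate n [(S1, True), (S2, True)]) | n. m = enat n}"

definition I2 :: "enat \<Rightarrow> coxeter_gen word set monoid" where
  "I2 m = presented_group (I2_relators m)"

definition I2_gen :: "enat \<Rightarrow> coxeter_gen \<Rightarrow> coxeter_gen word set" where
  "I2_gen m = pres_gen (I2_relators m)"


text \<open>
  The construction is a group, its relators hold, and it has the universal property
  of the presentation.
\<close>

lemma word_class_eq_iff: "word_class R u = word_class R v \<longleftrightarrow> pres_cong R u v"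
  unfolding word_class_def by (auto intro: pc_refl pc_sym pc_trans)

lemma pres_cong_append_left: "pres_cong R u v \<Longrightarrow> pres_cong R (w @ u) (w @ v)"
proof (induction rule: pres_cong.induct)
  case (pc_cancel u x e v)
  show ?case using pres_cong.pc_cancel[of R "w @ u" x e v] by simp
next
  case (pc_relator r u v)
  then show ?case using pres_cong.pc_relator[of r R "w @ u" v] by simp
qed (auto intro: pc_refl pc_sym pc_trans)

lemma pres_cong_append_right: "pres_cong R u v \<Longrightarrow> pres_cong R (u @ w) (v @ w)"
proof (induction rule: pres_cong.induct)
  case (pc_cancel u x e v)
  show ?case using pres_cong.pc_cancel[of R u x e "v @ w"] by simp
next
  case (pc_relator r u v)
  then show ?case using pres_cong.pc_relator[of r R u "v @ w"] by simp
qed (auto intro: pc_refl pc_sym pc_trans)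

lemma pres_cong_append:
  "pres_cong R u u' \<Longrightarrow> pres_cong R v v' \<Longrightarrow> pres_cong R (u @ v) (u' @ v')"
  by (meson pc_trans pres_cong_append_left pres_cong_append_right)

lemma carrier_presented_group: "carrier (presented_group R) = range (word_class R)"
  by (simp add: presented_group_def)

lemma one_presented_group: "\<one>\<^bsub>presented_group R\<^esub> = word_class R []"
  by (simp add: presented_group_def)

lemma mult_presented_group:
  "word_class R u \<otimes>\<^bsub>presented_group R\<^esub> word_class R v = word_class R (u @ v)"
proof -
  have "(\<exists>u'\<in>word_class R u. \<exists>v'\<in>word_class R v. pres_cong R (u' @ v') w)
          \<longleftrightarrow> pres_cong R (u @ v) w" for w
    unfolding word_class_def by (auto intro: pc_refl pc_trans pres_cong_append)
  then show ?thesis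
    by (simp add: presented_group_def word_class_def)
qed

definition inv_word :: "'g word \<Rightarrow> 'g word" where
  "inv_word u = rev (map (\<lambda>(x, e). (x, \<not> e)) u)"

lemma pres_cong_inv_word: "pres_cong R (inv_word u @ u) []"
proof (induction u)
  case Nil
  show ?case by (simp add: inv_word_def pc_refl)
next
  case (Cons l u)
  obtain x e where l: "l = (x, e)" by (cases l)
  have "pres_cong R (inv_word u @ [(x, \<not> e), (x, \<not> \<not> e)] @ u) (inv_word u @ u)"
    by (rule pc_cancel)
  then show ?case
    using Cons by (auto simp: inv_word_def l intro: pc_trans)
qed

lemma group_presented_group: "group (presented_group R)"
proof (rule groupI)
  show "\<exists>y\<in>carrier (presented_group R). y \<otimes>\<^bsub>presented_group R\<^esub> x = \<one>\<^bsub>presented_group R\<^esub>"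
    if "x \<in> carrier (presented_group R)" for x
    using that pres_cong_inv_word
    by (force simp: carrier_presented_group one_presented_group mult_presented_group
        word_class_eq_iff)
qed (auto simp: carrier_presented_group one_presented_group mult_presented_group)

lemma group_I2: "group (I2 m)"
  unfolding I2_def by (rule group_presented_group)

lemma pres_gen_closed: "pres_gen R x \<in> carrier (presented_group R)"
  by (simp add: pres_gen_def carrier_presented_group)

lemma I2_gen_closed: "I2_gen m x \<in> carrier (I2 m)"
  unfolding I2_gen_def I2_def by (rule pres_gen_closed)

lemma presented_group_relator:
  "r \<in> R \<Longrightarrow> word_class R r = \<one>\<^bsub>presented_group R\<^esub>"
  using pc_relator[of r R "[]" "[]"] by (simp add: one_presented_group word_class_eq_iff)

primrec eval_word :: "('b, 'c) monoid_scheme \<Rightarrow> ('g \<Rightarrow> 'b) \<Rightarrow> 'g word \<Rightarrow> 'b" where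
  "eval_word H f [] = \<one>\<^bsub>H\<^esub>"
| "eval_word H f (l # u) =
     (if snd l then f (fst l) else inv\<^bsub>H\<^esub> f (fst l)) \<otimes>\<^bsub>H\<^esub> eval_word H f u"

lemma presented_group_universal:
  assumes "group H" and f: "\<And>x. f x \<in> carrier H"
    and rel: "\<And>r. r \<in> R \<Longrightarrow> eval_word H f r = \<one>\<^bsub>H\<^esub>"
  shows "\<exists>h \<in> hom (presented_group R) H. \<forall>x. h (pres_gen R x) = f x"
proof -
  interpret group H by fact
  have cl: "eval_word H f u \<in> carrier H" for u
    by (induction u) (auto simp: f)
  have app: "eval_word H f (u @ v) = eval_word H f u \<otimes>\<^bsub>H\<^esub> eval_word H f v" for u v
    by (induction u) (auto simp: f cl m_assoc)
  have canc: "f x \<otimes>\<^bsub>H\<^esub> (inv\<^bsub>H\<^esub> f x \<otimes>\<^bsub>H\<^esub> eval_word H f u) = eval_word H f u"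
    "inv\<^bsub>H\<^esub> f x \<otimes>\<^bsub>H\<^esub> (f x \<otimes>\<^bsub>H\<^esub> eval_word H f u) = eval_word H f u" for x u
    by (simp_all add: m_assoc[symmetric] f cl)
  have resp: "eval_word H f u = eval_word H f v" if "pres_cong R u v" for u v
    using that
    by (induction rule: pres_cong.induct) (auto simp: app cl f rel canc)
  define h where "h X = eval_word H f (SOME u. u \<in> X)" for X
  have h: "h (word_class R u) = eval_word H f u" for u
  proof -
    have "(SOME v. v \<in> word_class R u) \<in> word_class R u"
      by (rule someI[of _ u]) (simp add: word_class_def pc_refl)
    then show ?thesis
      unfolding h_def using resp by (simp add: word_class_def)
  qed
  have "h \<in> hom (presented_group R) H"
    by (auto simp: hom_def carrier_presented_group mult_presented_group h app cl)
  moreover have "h (pres_gen R x) = f x" for x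
    by (simp add: pres_gen_def h f)
  ultimately show ?thesis by blast
qed

end

theory Submission imports Defs begin

text \<open>
  The element \<open>a = s\<^sub>1s\<^sub>2\<close> is a rotation and \<open>b = s\<^sub>1\<close> a reflection.  Everything rests on two
  facts about a group with two involutions \<open>s\<close>, \<open>t\<close>: the inverse of \<open>st\<close> is \<open>ts\<close>, and moving
  \<open>s\<close> past a power of \<open>st\<close> turns it into the same power of \<open>ts\<close>
  (\<open>involution_mult_int_pow\<close>).  Hence \<open>s(st)\<^sup>i = (ts)\<^sup>i s = (st)\<^bsup>-i\<^esup> s\<close> for every
  integer \<open>i\<close>; splitting off the last factor \<open>ts\<close> and cancelling \<open>s\<close> gives the other form \<open>(ts)\<^bsup>i-1\<^esup> t\<close>.
  For finite \<open>m\<close> the relator \<open>(s\<^sub>1s\<^sub>2)\<^sup>m\<close> allows the exponent \<open>-i\<close> to be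
  replaced by \<open>m - i\<close>.
\<close>

text \<open>
  The relation says \<open>w = xzx\<^bsup>-1\<^esup>\<close>, and conjugation by \<open>x\<close> commutes with taking powers; the
  form without inverses is the one that applies directly to words in involutions.
\<close>

lemma (in group) intertwining_int_pow:
  fixes i :: int
  assumes x: "x \<in> carrier G" and z: "z \<in> carrier G" and w: "w \<in> carrier G"
    and xz: "x \<otimes> z = w \<otimes> x"
  shows "x \<otimes> z [^] i = w [^] i \<otimes> x"
proof -
  have nat: "x \<otimes> z [^] k = w [^] k \<otimes> x" for k :: nat
  proof (induction k)
    case (Suc k)
    have "x \<otimes> z [^] Suc k = (x \<otimes> z [^] k) \<otimes> z"
      using x z by (simp add: m_assoc)
    also have "\<dots> = w [^] k \<otimes> (x \<otimes> z)"
      using Suc x z w by (simp add: m_assoc)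
    also have "\<dots> = w [^] Suc k \<otimes> x"
      using x w by (simp add: xz m_assoc)
    finally show ?case .
  qed (use x in simp)
  show ?thesis
  proof (cases i rule: int_cases2)
    case (nonneg k)
    then show ?thesis using nat by (simp add: int_pow_int)
  next
    case (nonpos k)
    have "w [^] k \<otimes> (x \<otimes> inv (z [^] k)) = x \<otimes> z [^] k \<otimes> inv (z [^] k)"
      using x z w by (simp add: nat m_assoc)
    also have "\<dots> = x"
      using x z by (simp add: m_assoc)
    finally have "x \<otimes> inv (z [^] k) = inv (w [^] k) \<otimes> x"
      using x z w by (metis inv_closed inv_solve_left m_closed nat_pow_closed)
    then show ?thesis
      using z w nonpos by (simp add: int_pow_neg int_pow_int)
  qed
qed

context group
begin

context
  fixes s t
  assumes s: "s \<in> carrier G" and t: "t \<in> carrier G"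
    and ss: "s \<otimes> s = \<one>" and tt: "t \<otimes> t = \<one>"
begin

lemma involution_cancel_left: "x \<in> carrier G \<Longrightarrow> s \<otimes> (s \<otimes> x) = x"
  using s by (simp add: m_assoc[symmetric] ss)

lemma inv_mult_involutions: "inv (s \<otimes> t) = t \<otimes> s"
  using s t ss tt by (simp add: inv_mult_group inv_equality)

lemma int_pow_mult_involutions_swap: "(t \<otimes> s) [^] (i::int) = (s \<otimes> t) [^] (- i)"
  using s t by (simp add: inv_mult_involutions[symmetric] int_pow_inv int_pow_neg)

lemma involution_mult_int_pow: "s \<otimes> (s \<otimes> t) [^] (i::int) = (t \<otimes> s) [^] i \<otimes> s"
  using s t by (intro intertwining_int_pow) (simp_all add: m_assoc involution_cancel_left ss)

lemma involution_mult_int_pow_pred: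
  "s \<otimes> (s \<otimes> t) [^] (i::int) = (t \<otimes> s) [^] (i - 1) \<otimes> t"
proof -
  have "(t \<otimes> s) [^] i = (t \<otimes> s) [^] (i - 1) \<otimes> (t \<otimes> s)"
    using int_pow_mult[of "t \<otimes> s" "i - 1" 1] s t by (simp add: int_pow_1)
  then show ?thesis
    using s t by (simp add: involution_mult_int_pow m_assoc ss)
qed

end

lemma int_pow_diff_of_pow_eq_one:
  fixes i :: int
  assumes "x \<in> carrier G" "x [^] (n::nat) = \<one>"
  shows "x [^] (int n - i) = x [^] (- i)"
  using assms int_pow_diff[of x "int n" i] by (simp add: int_pow_int int_pow_neg)

end

lemma I2_gen_involution: "I2_gen m x \<otimes>\<^bsub>I2 m\<^esub> I2_gen m x = \<one>\<^bsub>I2 m\<^esub>"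
proof -
  have "[(x, True), (x, True)] \<in> I2_relators m"
    by (cases x) (auto simp: I2_relators_def)
  then show ?thesis
    by (simp add: I2_def I2_gen_def pres_gen_def mult_presented_group presented_group_relator)
qed

lemma I2_rotation_pow_eq_one:
  "(I2_gen (enat n) S1 \<otimes>\<^bsub>I2 (enat n)\<^esub> I2_gen (enat n) S2) [^]\<^bsub>I2 (enat n)\<^esub> n
     = \<one>\<^bsub>I2 (enat n)\<^esub>"
proof -
  let ?R = "I2_relators (enat n)"
  have "word_class ?R u [^]\<^bsub>presented_group ?R\<^esub> k = word_class ?R (concat (replicate k u))"
    for u and k :: nat
  proof (induction k)
    case (Suc k)
    \<comment> \<open>Powers multiply on the right, whereas \<open>replicate\<close> adds its new copy on the left.\<close>
    have "concat (replicate k u) @ u = u @ concat (replicate k u)"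
      by (induction k) simp_all
    then show ?case
      using Suc by (simp add: mult_presented_group)
  qed (simp add: one_presented_group)
  moreover have "concat (replicate n [(S1, True), (S2, True)]) \<in> ?R"
    by (auto simp: I2_relators_def)
  ultimately show ?thesis
    by (simp add: I2_def I2_gen_def pres_gen_def mult_presented_group presented_group_relator)
qed

theorem proposition2p5:
  fixes m :: enat and G (structure)
  assumes m: "m \<ge> 2"
    and G: "G = I2 m" and s1: "s1 = I2_gen m S1" and s2: "s2 = I2_gen m S2"
    and b: "b = s1" and a: "a = s1 \<otimes> s2"
  shows "b = s1
    \<and> b \<otimes> a = s2
    \<and> (\<forall>n. m = enat n \<longrightarrow> (\<forall>i::int. 1 < i \<and> real_of_int i \<le> (real n + 1) / 2 \<longrightarrow>
          b \<otimes> a [^] i = (s2 \<otimes> s1) [^] (i - 1) \<otimes> s2))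
    \<and> (m = \<infinity> \<longrightarrow> (\<forall>i::int. i > 1 \<longrightarrow>
          b \<otimes> a [^] i = (s2 \<otimes> s1) [^] (i - 1) \<otimes> s2))
    \<and> (\<forall>n. m = enat n \<longrightarrow> (\<forall>i::int. (real n + 1) / 2 \<le> real_of_int i \<and> i < int n \<longrightarrow>
          b \<otimes> a [^] i = (s1 \<otimes> s2) [^] (int n - i) \<otimes> s1))
    \<and> (m = \<infinity> \<longrightarrow> (\<forall>i::int. i < 0 \<longrightarrow>
          b \<otimes> a [^] i = (s1 \<otimes> s2) [^] (- i) \<otimes> s1))
    \<and> (\<forall>n. m = enat n \<longrightarrow> (\<forall>i::int. 0 < i \<and> real_of_int i \<le> real n / 2 \<longrightarrow>
          a [^] i = (s1 \<otimes> s2) [^] i))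
    \<and> (m = \<infinity> \<longrightarrow> (\<forall>i::int. i > 0 \<longrightarrow>
          a [^] i = (s1 \<otimes> s2) [^] i))
    \<and> (\<forall>n. m = enat n \<longrightarrow> (\<forall>i::int. real n / 2 \<le> real_of_int i \<and> i < int n \<longrightarrow>
          a [^] i = (s2 \<otimes> s1) [^] (int n - i)))
    \<and> (m = \<infinity> \<longrightarrow> (\<forall>i::int. i < 0 \<longrightarrow>
          a [^] i = (s2 \<otimes> s1) [^] (- i)))"
proof -
  interpret group G
    unfolding G by (rule group_I2)
  have c1: "s1 \<in> carrier G" and c2: "s2 \<in> carrier G"
    by (simp_all add: G s1 s2 I2_gen_closed)
  have i1: "s1 \<otimes> s1 = \<one>" and i2: "s2 \<otimes> s2 = \<one>"
    by (simp_all add: G s1 s2 I2_gen_involution)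
  note swap = int_pow_mult_involutions_swap[OF c1 c2 i1 i2]
  have period: "(s1 \<otimes> s2) [^] (int n - i) = (s1 \<otimes> s2) [^] (- i)"
    if "m = enat n" for n and i :: int
  proof (rule int_pow_diff_of_pow_eq_one)
    show "s1 \<otimes> s2 \<in> carrier G"
      using c1 c2 by (rule m_closed)
    show "(s1 \<otimes> s2) [^] n = \<one>"
      using I2_rotation_pow_eq_one[of n] that by (simp add: G s1 s2)
  qed
  have reflection_pred: "b \<otimes> a [^] i = (s2 \<otimes> s1) [^] (i - 1) \<otimes> s2" for i :: int
    unfolding a b by (rule involution_mult_int_pow_pred[OF c1 c2 i1 i2])
  have reflection_neg: "b \<otimes> a [^] i = (s1 \<otimes> s2) [^] (- i) \<otimes> s1" for i :: int
    unfolding a b by (simp add: involution_mult_int_pow[OF c1 c2 i1 i2] swap)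
  have reflection_period: "b \<otimes> a [^] i = (s1 \<otimes> s2) [^] (int n - i) \<otimes> s1"
    if "m = enat n" for n and i :: int
    by (simp only: reflection_neg period[OF that])
  have rotation: "a [^] i = (s1 \<otimes> s2) [^] i" for i :: int
    by (simp only: a)
  have rotation_neg: "a [^] i = (s2 \<otimes> s1) [^] (- i)" for i :: int
    by (simp add: a swap)
  have rotation_period: "a [^] i = (s2 \<otimes> s1) [^] (int n - i)" if "m = enat n" for n and i :: int
    \<comment> \<open>The period of \<open>s\<^sub>1s\<^sub>2\<close>, taken at the exponent \<open>n - i\<close>.\<close>
    using period[OF that, of "int n - i"] by (simp add: a swap)
  have "b \<otimes> a = s2"
    unfolding a b by (rule involution_cancel_left[OF c1 c2 i1 i2 c2])
  then show ?thesis
    using b reflection_pred reflection_neg reflection_period rotation rotation_neg rotation_period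
    by blast
qed

end
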